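(* Let $R$ be a fully almost prime ring which is right S-unital. If $M_1$ and $M_2$ are two distinct maximal ideals of $R$ (thus $R$ is not a local ring), then the following hold. (1) $M_1M_2=M_2M_1$. (2) $M_1\cap M_2=M_1M_2$, and this ideal is idempotent, i.e. $(M_1\cap M_2)^2=M_1\cap M_2$.
   Context: Rings are associative, not necessarily commutative, and not necessarily with unity. "Ideal" without qualification means two-sided ideal; maximal ideals are two-sided, proper, and maximal among proper two-sided ideals. For ideals $A,B$, $AB$ is the additive subgroup generated by all products $ab$ with $a\in A$, $b\in B$, and $P^2=PP$. A proper ideal $P$ of $R$ is an almost prime ideal if for all ideals $A,B$ of $R$, $AB\subseteq P$ and $AB\not\subseteq P^2$ imply $A\subseteq P$ or $B\subseteq P$. $R$ is a fully almost prime ring if every proper ideal of $R$ is an almost prime ideal. $R$ is right S-unital if $a\in aR$ for all $a\in R$. A local ring is a ring with unity having a unique maximal right ideal. *)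

theory Defs
  imports Main "HOL-Computational_Algebra.Group_Closure"
begin

(* The class "ring" demands neither commutativity of the multiplication nor a unity.
   The ring R is the whole type 'a; properties of R itself take an argument of type "'a itself". *)

definition right_ideal :: "'a::ring set \<Rightarrow> bool" where
  "right_ideal I \<longleftrightarrow>
     0 \<in> I \<and> (\<forall>a\<in>I. \<forall>b\<in>I. a - b \<in> I) \<and> (\<forall>a\<in>I. \<forall>r. a * r \<in> I)"

definition two_sided_ideal :: "'a::ring set \<Rightarrow> bool" where
  "two_sided_ideal I \<longleftrightarrow>
     0 \<in> I \<and> (\<forall>a\<in>I. \<forall>b\<in>I. a - b \<in> I) \<and> (\<forall>a\<in>I. \<forall>r. a * r \<in> I \<and> r * a \<in> I)"

definition ideal_prod :: "'a::ring set \<Rightarrow> 'a set \<Rightarrow> 'a set" where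
  "ideal_prod A B = group_closure {a * b | a b. a \<in> A \<and> b \<in> B}"

definition maximal_ideal :: "'a::ring set \<Rightarrow> bool" where
  "maximal_ideal M \<longleftrightarrow>
     two_sided_ideal M \<and> M \<noteq> UNIV \<and>
     (\<forall>J. two_sided_ideal J \<longrightarrow> J \<noteq> UNIV \<longrightarrow> M \<subseteq> J \<longrightarrow> J = M)"

definition maximal_right_ideal :: "'a::ring set \<Rightarrow> bool" where
  "maximal_right_ideal M \<longleftrightarrow>
     right_ideal M \<and> M \<noteq> UNIV \<and>
     (\<forall>J. right_ideal J \<longrightarrow> J \<noteq> UNIV \<longrightarrow> M \<subseteq> J \<longrightarrow> J = M)"

definition almost_prime_ideal :: "'a::ring set \<Rightarrow> bool" where
  "almost_prime_ideal P \<longleftrightarrow>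
     two_sided_ideal P \<and> P \<noteq> UNIV \<and>
     (\<forall>A B. two_sided_ideal A \<longrightarrow> two_sided_ideal B \<longrightarrow>
        ideal_prod A B \<subseteq> P \<longrightarrow> \<not> ideal_prod A B \<subseteq> ideal_prod P P \<longrightarrow> A \<subseteq> P \<or> B \<subseteq> P)"

definition fully_almost_prime_ring :: "'a::ring itself \<Rightarrow> bool" where
  "fully_almost_prime_ring _ \<longleftrightarrow>
     (\<forall>P::'a set. two_sided_ideal P \<longrightarrow> P \<noteq> UNIV \<longrightarrow> almost_prime_ideal P)"

definition right_S_unital :: "'a::ring itself \<Rightarrow> bool" where
  "right_S_unital _ \<longleftrightarrow> (\<forall>a::'a. a \<in> {a * r | r. True})"

definition has_unity :: "'a::ring itself \<Rightarrow> bool" where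
  "has_unity _ \<longleftrightarrow> (\<exists>e::'a. \<forall>a. e * a = a \<and> a * e = a)"

definition local_ring :: "'a::ring itself \<Rightarrow> bool" where
  "local_ring R \<longleftrightarrow> has_unity R \<and> (\<exists>!M::'a set. maximal_right_ideal M)"

end

theory Submission
  imports Defs
begin

text \<open>
  Write \<open>P = M1 \<inter> M2\<close>. The products \<open>M1 M2\<close> and \<open>M2 M1\<close> lie in \<open>P\<close> and contain \<open>P\<^sup>2\<close>. Since
  neither of two distinct maximal ideals contains the other, neither lies in \<open>P\<close>; so almost
  primeness of \<open>P\<close> leaves only the possibility that both products lie in \<open>P\<^sup>2\<close>, whence
  \<open>M1 M2 = P\<^sup>2 = M2 M1\<close> (lemma \<open>product_eq_square_of_intersection\<close>).

  What remains is \<open>P \<subseteq> P\<^sup>2\<close>. Distinct maximal ideals are comaximal, \<open>M1 + M2 = R\<close>, and right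
  S-unitality writes each \<open>x \<in> P\<close> as \<open>x r\<close>. Splitting \<open>r = a + b\<close> along \<open>M1 + M2\<close> gives
  \<open>x = x a + x b\<close>, where \<open>x a \<in> M2 M1\<close> and \<open>x b \<in> M1 M2\<close>; both of these are \<open>P\<^sup>2\<close>
  (lemma \<open>intersection_subset_products\<close>).

  Finally, a ring with unity and a single maximal right ideal \<open>N\<close> cannot have two comaximal
  proper ideals: by Zorn's lemma both would be contained in \<open>N\<close>, and then so would their sum \<open>R\<close>.
\<close>

lemma right_ideal_if_two_sided: "two_sided_ideal I \<Longrightarrow> right_ideal I"
  by (auto simp: two_sided_ideal_def right_ideal_def)

lemma right_ideal_add:
  assumes "right_ideal I" "x \<in> I" "y \<in> I"
  shows "x + y \<in> I"
proof -
  have "x - (0 - y) \<in> I"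
    using assms unfolding right_ideal_def by blast
  then show ?thesis by simp
qed

lemma two_sided_ideal_Int:
  "two_sided_ideal I \<Longrightarrow> two_sided_ideal J \<Longrightarrow> two_sided_ideal (I \<inter> J)"
  by (auto simp: two_sided_ideal_def)

lemma two_sided_ideal_sum:
  assumes I: "two_sided_ideal I" and J: "two_sided_ideal J"
  shows "two_sided_ideal {a + b | a b. a \<in> I \<and> b \<in> J}" (is "two_sided_ideal ?S")
  unfolding two_sided_ideal_def
proof (intro conjI ballI allI)
  have "0 + 0 \<in> ?S"
    using I J unfolding two_sided_ideal_def by blast
  then show "0 \<in> ?S" by simp
next
  fix x y assume "x \<in> ?S" "y \<in> ?S"
  then obtain a b c d where *: "x = a + b" "y = c + d" "a \<in> I" "b \<in> J" "c \<in> I" "d \<in> J"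
    by blast
  have "x - y = (a - c) + (b - d)" by (simp add: *)
  moreover have "a - c \<in> I" "b - d \<in> J"
    using * I J unfolding two_sided_ideal_def by blast+
  ultimately show "x - y \<in> ?S" by blast
next
  fix x r assume "x \<in> ?S"
  then obtain a b where *: "x = a + b" "a \<in> I" "b \<in> J" by blast
  have "x * r = a * r + b * r" "r * x = r * a + r * b"
    by (simp_all add: * algebra_simps)
  moreover have "a * r \<in> I" "r * a \<in> I" "b * r \<in> J" "r * b \<in> J"
    using * I J unfolding two_sided_ideal_def by blast+
  ultimately show "x * r \<in> ?S" "r * x \<in> ?S" by blast+
qed

lemma ideal_prod_memI: "a \<in> A \<Longrightarrow> b \<in> B \<Longrightarrow> a * b \<in> ideal_prod A B"
  unfolding ideal_prod_def by (rule group_closure.base) blast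

lemma ideal_prod_add_mem:
  "x \<in> ideal_prod A B \<Longrightarrow> y \<in> ideal_prod A B \<Longrightarrow> x + y \<in> ideal_prod A B"
  unfolding ideal_prod_def by (rule group_closure_add)

lemma ideal_prod_subsetI:
  assumes "\<And>a b. a \<in> A \<Longrightarrow> b \<in> B \<Longrightarrow> a * b \<in> C"
    and "0 \<in> C" and "\<And>x y. x \<in> C \<Longrightarrow> y \<in> C \<Longrightarrow> x - y \<in> C"
  shows "ideal_prod A B \<subseteq> C"
proof
  fix x assume "x \<in> ideal_prod A B"
  then show "x \<in> C"
    unfolding ideal_prod_def by induction (use assms in auto)
qed

lemma ideal_prod_mono:
  assumes "A \<subseteq> A'" "B \<subseteq> B'"
  shows "ideal_prod A B \<subseteq> ideal_prod A' B'"
proof (rule ideal_prod_subsetI)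
  show "a * b \<in> ideal_prod A' B'" if "a \<in> A" "b \<in> B" for a b
    using that assms by (blast intro: ideal_prod_memI)
qed (auto simp: ideal_prod_def intro: group_closure.diff)

lemma ideal_prod_subset_Int:
  assumes "two_sided_ideal A" "two_sided_ideal B"
  shows "ideal_prod A B \<subseteq> A \<inter> B"
  using assms by (intro ideal_prod_subsetI) (auto simp: two_sided_ideal_def)

lemma comaximal_if_distinct_maximal:
  assumes "maximal_ideal M1" "maximal_ideal M2" "M1 \<noteq> M2"
  obtains a b where "a \<in> M1" "b \<in> M2" "r = a + b"
proof -
  define S where "S = {a + b | a b. a \<in> M1 \<and> b \<in> M2}"
  have id: "two_sided_ideal M1" "two_sided_ideal M2"
    using assms by (auto simp: maximal_ideal_def)
  then have zero: "0 \<in> M1" "0 \<in> M2" by (auto simp: two_sided_ideal_def)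
  have "M1 \<subseteq> S"
  proof
    fix x assume "x \<in> M1"
    then have "x + 0 \<in> S" using zero unfolding S_def by blast
    then show "x \<in> S" by simp
  qed
  moreover have "M2 \<subseteq> S"
  proof
    fix x assume "x \<in> M2"
    then have "0 + x \<in> S" using zero unfolding S_def by blast
    then show "x \<in> S" by simp
  qed
  moreover have "two_sided_ideal S"
    unfolding S_def by (rule two_sided_ideal_sum[OF id])
  \<comment> \<open>A proper sum would by maximality equal both summands.\<close>
  ultimately have "S = UNIV"
    using assms unfolding maximal_ideal_def by metis
  then have "r \<in> S" by simp
  then show thesis using that unfolding S_def by blast
qed

lemma product_eq_square_of_intersection:
  assumes prime: "almost_prime_ideal (A \<inter> B)"
    and A: "two_sided_ideal A" and B: "two_sided_ideal B"
    and incomparable: "\<not> A \<subseteq> B" "\<not> B \<subseteq> A"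
  shows "ideal_prod A B = ideal_prod (A \<inter> B) (A \<inter> B)"
proof
  have "\<not> A \<subseteq> A \<inter> B" "\<not> B \<subseteq> A \<inter> B"
    using incomparable by auto
  then show "ideal_prod A B \<subseteq> ideal_prod (A \<inter> B) (A \<inter> B)"
    using prime A B ideal_prod_subset_Int[OF A B] unfolding almost_prime_ideal_def by blast
  show "ideal_prod (A \<inter> B) (A \<inter> B) \<subseteq> ideal_prod A B"
    by (rule ideal_prod_mono) auto
qed

text \<open>
  In symbols, \<open>A \<inter> B = (A \<inter> B) R = (A \<inter> B) A + (A \<inter> B) B \<subseteq> B A + A B\<close>. The set \<open>C\<close> stands for
  any additively closed set that contains both products, so that no sum of ideals is needed in
  the conclusion.
\<close>

lemma intersection_subset_products:
  fixes A B C :: "'a::ring set"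
  assumes unital: "right_S_unital TYPE('a)"
    and comaximal: "\<And>r. \<exists>a\<in>A. \<exists>b\<in>B. r = a + b"
    and products: "ideal_prod B A \<subseteq> C" "ideal_prod A B \<subseteq> C"
    and add: "\<And>x y. x \<in> C \<Longrightarrow> y \<in> C \<Longrightarrow> x + y \<in> C"
  shows "A \<inter> B \<subseteq> C"
proof
  fix x assume x: "x \<in> A \<inter> B"
  obtain r where r: "x = x * r"
    using unital unfolding right_S_unital_def by blast
  obtain a b where ab: "a \<in> A" "b \<in> B" "r = a + b"
    using comaximal by blast
  have "x * a \<in> C" "x * b \<in> C"
    using x ab products by (blast intro: ideal_prod_memI)+
  then have "x * a + x * b \<in> C" by (rule add)
  then show "x \<in> C" using r ab by (simp add: distrib_left)
qed

text \<open>
  With a unity \<open>e\<close>, a right ideal is proper exactly when it omits \<open>e\<close>. This condition survives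
  unions of chains, which makes Zorn's lemma applicable.
\<close>

lemma proper_right_ideal_subset_maximal:
  fixes I :: "'a::ring set"
  assumes unity: "has_unity TYPE('a)" and I: "right_ideal I" "I \<noteq> UNIV"
  obtains N where "maximal_right_ideal N" "I \<subseteq> N"
proof -
  obtain e :: 'a where e: "\<And>a. e * a = a"
    using unity unfolding has_unity_def by blast
  have proper: "J = UNIV" if "right_ideal J" "e \<in> J" for J
  proof -
    have "e * r \<in> J" for r
      using that unfolding right_ideal_def by blast
    then show ?thesis by (auto simp: e)
  qed
  let ?F = "{J. right_ideal J \<and> I \<subseteq> J \<and> e \<notin> J}"
  have "\<exists>N\<in>?F. \<forall>X\<in>?F. N \<subseteq> X \<longrightarrow> X = N"
  proof (rule subset_Zorn_nonempty)
    show "?F \<noteq> {}" using I proper by blast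
  next
    fix C assume ne: "C \<noteq> {}" and "subset.chain ?F C"
    then have mem: "\<And>J. J \<in> C \<Longrightarrow> right_ideal J \<and> I \<subseteq> J \<and> e \<notin> J"
      and lin: "\<And>J K. J \<in> C \<Longrightarrow> K \<in> C \<Longrightarrow> J \<subseteq> K \<or> K \<subseteq> J"
      by (auto simp: subset_chain_def)
    have "right_ideal (\<Union>C)"
      unfolding right_ideal_def
    proof (intro conjI ballI allI)
      show "0 \<in> \<Union>C" using ne mem unfolding right_ideal_def by blast
    next
      fix a b assume "a \<in> \<Union>C" "b \<in> \<Union>C"
      then obtain K where "K \<in> C" "a \<in> K" "b \<in> K"
        using lin by blast
      moreover from this have "a - b \<in> K" using mem by (simp add: right_ideal_def)
      ultimately show "a - b \<in> \<Union>C" by blast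
    next
      fix a r assume "a \<in> \<Union>C"
      then obtain K where "K \<in> C" "a \<in> K" by blast
      moreover from this have "a * r \<in> K" using mem by (simp add: right_ideal_def)
      ultimately show "a * r \<in> \<Union>C" by blast
    qed
    then show "\<Union>C \<in> ?F" using ne mem by blast
  qed
  then obtain N where "N \<in> ?F" and max: "\<forall>X\<in>?F. N \<subseteq> X \<longrightarrow> X = N" ..
  then have N: "right_ideal N" "I \<subseteq> N" "e \<notin> N"
    by simp_all
  have "maximal_right_ideal N"
    unfolding maximal_right_ideal_def
  proof (intro conjI allI impI)
    show "N \<noteq> UNIV" using N by blast
    show "J = N" if "right_ideal J" "J \<noteq> UNIV" "N \<subseteq> J" for J
    proof -
      have "J \<in> ?F" using that N(2) proper by auto
      then show ?thesis using max that(3) by simp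
    qed
  qed (rule N)
  then show thesis using N that by blast
qed

lemma not_local_if_comaximal:
  fixes I J :: "'a::ring set"
  assumes I: "right_ideal I" "I \<noteq> UNIV" and J: "right_ideal J" "J \<noteq> UNIV"
    and comaximal: "\<And>r. \<exists>a\<in>I. \<exists>b\<in>J. r = a + b"
  shows "\<not> local_ring TYPE('a)"
proof
  assume local_R: "local_ring TYPE('a)"
  then have unity: "has_unity TYPE('a)"
    and unique: "\<And>K N :: 'a set. maximal_right_ideal K \<Longrightarrow> maximal_right_ideal N \<Longrightarrow> K = N"
    unfolding local_ring_def by auto
  obtain N where N: "maximal_right_ideal N" "I \<subseteq> N"
    using proper_right_ideal_subset_maximal[OF unity I] .
  obtain K where K: "maximal_right_ideal K" "J \<subseteq> K"
    using proper_right_ideal_subset_maximal[OF unity J] .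
  have "J \<subseteq> N" using unique[OF N(1) K(1)] K by simp
  have "r \<in> N" for r
  proof -
    obtain a b where "a \<in> I" "b \<in> J" "r = a + b" using comaximal by blast
    then show ?thesis
      using right_ideal_add N \<open>J \<subseteq> N\<close> unfolding maximal_right_ideal_def by blast
  qed
  then show False using N unfolding maximal_right_ideal_def by blast
qed

theorem theorem2p10:
  fixes M1 M2 :: "'a::ring set"
  assumes "fully_almost_prime_ring TYPE('a)"
    and "right_S_unital TYPE('a)"
    and "maximal_ideal M1" and "maximal_ideal M2"
    and "M1 \<noteq> M2"
  shows "\<not> local_ring TYPE('a)
    \<and> ideal_prod M1 M2 = ideal_prod M2 M1
    \<and> M1 \<inter> M2 = ideal_prod M1 M2
    \<and> ideal_prod (M1 \<inter> M2) (M1 \<inter> M2) = M1 \<inter> M2"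
proof -
  have id: "two_sided_ideal M1" "two_sided_ideal M2"
    and proper: "M1 \<noteq> UNIV" "M2 \<noteq> UNIV"
    using assms(3,4) by (auto simp: maximal_ideal_def)
  have incomparable: "\<not> M1 \<subseteq> M2" "\<not> M2 \<subseteq> M1"
    using assms(3-5) unfolding maximal_ideal_def by blast+
  have comaximal: "\<exists>a\<in>M1. \<exists>b\<in>M2. r = a + b" for r
    using comaximal_if_distinct_maximal[OF assms(3-5)] by metis
  let ?P = "M1 \<inter> M2"
  have prime: "almost_prime_ideal ?P"
    using assms(1) two_sided_ideal_Int[OF id] proper
    unfolding fully_almost_prime_ring_def by blast
  have square1: "ideal_prod M1 M2 = ideal_prod ?P ?P"
    using product_eq_square_of_intersection[OF prime id incomparable] .
  have square2: "ideal_prod M2 M1 = ideal_prod ?P ?P"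
    using product_eq_square_of_intersection[of M2 M1] prime id incomparable
    by (simp add: Int_commute)
  have "?P \<subseteq> ideal_prod ?P ?P"
    using intersection_subset_products[OF assms(2) comaximal] square1 square2
    by (simp add: ideal_prod_add_mem)
  moreover have "ideal_prod ?P ?P \<subseteq> ?P"
    using ideal_prod_subset_Int[OF id] square1 by simp
  ultimately have "ideal_prod ?P ?P = ?P" by blast
  moreover have "\<not> local_ring TYPE('a)"
    using not_local_if_comaximal[OF _ proper(1) _ proper(2) comaximal]
      id right_ideal_if_two_sided by blast
  ultimately show ?thesis using square1 square2 by simp
qed

end
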